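(* Let $\Omega\subset\mathbb{R}^2$ be compact and let $F:\Omega\to\mathbb{R}$ be continuous, non-decreasing in its first variable and non-increasing in its second variable. Suppose that $\Omega$ is invariant, i.e. $(F(x,y),x)\in\Omega$ whenever $(x,y)\in\Omega$. Suppose that $F$ has a nice extension $\widetilde{F}:[a,b]^2\to[a,b]$ over a rectangular domain $[a,b]^2\supseteq\Omega$ such that $\widetilde{F}$ has no artificial fixed points. Then for every $(x_0,x_{-1})\in\Omega$, the sequence defined by $x_{n+1}=F(x_n,x_{n-1})$, $n=0,1,\ldots$, converges to a fixed point of $F$.
   Context: A continuous function $\widetilde{F}$ on $[a,b]^2\supseteq\Omega$ is an extension of $F$ if $\widetilde{F}=F$ on $\Omega$ and $\widetilde{F}$ has the same monotonicity as $F$ (here: non-decreasing in the first variable, non-increasing in the second). It is a nice extension if moreover the range of $\widetilde{F}$ coincides with the range of $F$. A fixed point of $F$ is a number $x^*$ with $(x^*,x^* )\in\Omega$ and $F(x^*,x^* )=x^*$. An artificial fixed point of $\widetilde{F}$ is a solution $(x,y)\in[a,b]^2$ of the system $\widetilde{F}(x,y)=x$, $\widetilde{F}(y,x)=y$ with $x\neq y$. *)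

theory Defs
  imports "HOL-Analysis.Analysis"
begin

definition mixed_monotone_on :: "(real \<times> real) set \<Rightarrow> (real \<times> real \<Rightarrow> real) \<Rightarrow> bool" where
  "mixed_monotone_on S F \<longleftrightarrow>
     (\<forall>y. mono_on {x. (x, y) \<in> S} (\<lambda>x. F (x, y))) \<and>
     (\<forall>x. antimono_on {y. (x, y) \<in> S} (\<lambda>y. F (x, y)))"

definition invariant_domain :: "(real \<times> real) set \<Rightarrow> (real \<times> real \<Rightarrow> real) \<Rightarrow> bool" where
  "invariant_domain \<Omega> F \<longleftrightarrow> (\<forall>x y. (x, y) \<in> \<Omega> \<longrightarrow> (F (x, y), x) \<in> \<Omega>)"

definition is_extension ::
  "(real \<times> real) set \<Rightarrow> (real \<times> real \<Rightarrow> real) \<Rightarrow> real \<Rightarrow> real \<Rightarrow> (real \<times> real \<Rightarrow> real) \<Rightarrow> bool" where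
  "is_extension \<Omega> F a b G \<longleftrightarrow>
     \<Omega> \<subseteq> {a..b} \<times> {a..b} \<and>
     continuous_on ({a..b} \<times> {a..b}) G \<and>
     (\<forall>p\<in>\<Omega>. G p = F p) \<and>
     mixed_monotone_on ({a..b} \<times> {a..b}) G"

definition nice_extension ::
  "(real \<times> real) set \<Rightarrow> (real \<times> real \<Rightarrow> real) \<Rightarrow> real \<Rightarrow> real \<Rightarrow> (real \<times> real \<Rightarrow> real) \<Rightarrow> bool" where
  "nice_extension \<Omega> F a b G \<longleftrightarrow>
     is_extension \<Omega> F a b G \<and> G ` ({a..b} \<times> {a..b}) = F ` \<Omega>"

definition fixed_point :: "(real \<times> real) set \<Rightarrow> (real \<times> real \<Rightarrow> real) \<Rightarrow> real \<Rightarrow> bool" where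
  "fixed_point \<Omega> F z \<longleftrightarrow> (z, z) \<in> \<Omega> \<and> F (z, z) = z"

definition artificial_fixed_point ::
  "real \<Rightarrow> real \<Rightarrow> (real \<times> real \<Rightarrow> real) \<Rightarrow> real \<times> real \<Rightarrow> bool" where
  "artificial_fixed_point a b G = (\<lambda>(x, y).
     (x, y) \<in> {a..b} \<times> {a..b} \<and> G (x, y) = x \<and> G (y, x) = y \<and> x \<noteq> y)"

(* Indices are shifted by one: orbit F x0 xm1 n is x_{n-1}, where x_0 = x0 and x_{-1} = xm1. *)
fun orbit :: "(real \<times> real \<Rightarrow> real) \<Rightarrow> real \<Rightarrow> real \<Rightarrow> nat \<Rightarrow> real" where
  "orbit F x0 xm1 0 = xm1"
| "orbit F x0 xm1 (Suc 0) = x0"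
| "orbit F x0 xm1 (Suc (Suc n)) = F (orbit F x0 xm1 (Suc n), orbit F x0 xm1 n)"

end

theory Submission
  imports Defs
begin

text \<open>Iterating the symmetrised map \<open>(x, y) \<mapsto> (G (x, y), G (y, x))\<close> from \<open>(a, b)\<close> gives
  nested intervals \<open>[m\<^sub>k, M\<^sub>k]\<close>, and two steps of the recursion move the orbit from each interval into the
  next. The limit of the endpoints solves the system \<open>G (m, M) = m\<close>, \<open>G (M, m) = M\<close>, so in the absence
  of artificial fixed points the intervals shrink to one point, to which the orbit is squeezed.\<close>

text \<open>One variable moves at a time, through the corner \<open>(x', y)\<close>. This corner is
  available because the domain is a product.\<close>

lemma mixed_monotone_onD:
  assumes "mixed_monotone_on (A \<times> B) G"
    and "x \<in> A" "x' \<in> A" "y \<in> B" "y' \<in> B" "x \<le> x'" "y' \<le> y"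
  shows "G (x, y) \<le> G (x', y')"
proof -
  have "mono_on {u. (u, y) \<in> A \<times> B} (\<lambda>u. G (u, y))"
    and "antimono_on {v. (x', v) \<in> A \<times> B} (\<lambda>v. G (x', v))"
    using assms(1) unfolding mixed_monotone_on_def by blast+
  then have "G (x, y) \<le> G (x', y)" "G (x', y) \<le> G (x', y')"
    using assms by (auto simp: monotone_on_def)
  then show ?thesis by linarith
qed

lemma orbit_in_invariant_domain:
  assumes "invariant_domain \<Omega> F" "(x0, xm1) \<in> \<Omega>"
  shows "(orbit F x0 xm1 (Suc n), orbit F x0 xm1 n) \<in> \<Omega>"
  using assms by (induction n) (auto simp: invariant_domain_def)

fun bracket :: "(real \<times> real \<Rightarrow> real) \<Rightarrow> real \<Rightarrow> real \<Rightarrow> nat \<Rightarrow> real \<times> real" where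
  "bracket G a b 0 = (a, b)"
| "bracket G a b (Suc k) =
     (G (bracket G a b k), G (snd (bracket G a b k), fst (bracket G a b k)))"

text \<open>The claims go through one joint induction: each endpoint inequality at \<open>k\<close>
  yields its successor by mixed monotonicity, which applies only while the endpoints stay in
  \<open>{a..b}\<close>.\<close>

lemma bracket_nested:
  assumes "mixed_monotone_on ({a..b} \<times> {a..b}) G" "G ` ({a..b} \<times> {a..b}) \<subseteq> {a..b}" "a \<le> b"
  shows "a \<le> fst (bracket G a b k)" "snd (bracket G a b k) \<le> b"
    and "fst (bracket G a b k) \<le> snd (bracket G a b k)"
    and "fst (bracket G a b k) \<le> fst (bracket G a b (Suc k))"
    and "snd (bracket G a b (Suc k)) \<le> snd (bracket G a b k)"
proof -
  have in_box: "G (x, y) \<in> {a..b}" if "x \<in> {a..b}" "y \<in> {a..b}" for x y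
    using assms(2) that by blast
  have "a \<le> fst (bracket G a b k) \<and> snd (bracket G a b k) \<le> b
    \<and> fst (bracket G a b k) \<le> snd (bracket G a b k)
    \<and> fst (bracket G a b k) \<le> fst (bracket G a b (Suc k))
    \<and> snd (bracket G a b (Suc k)) \<le> snd (bracket G a b k)"
  proof (induction k)
    case 0
    then show ?case using assms(3) in_box[of a b] in_box[of b a] by auto
  next
    case (Suc k)
    obtain m M where mM: "bracket G a b k = (m, M)" by fastforce
    then have m: "m \<in> {a..b}" and M: "M \<in> {a..b}" and le: "m \<le> M"
      and up: "m \<le> G (m, M)" and down: "G (M, m) \<le> M"
      using Suc by auto
    have box: "G (m, M) \<in> {a..b}" "G (M, m) \<in> {a..b}"
      using in_box m M by auto
    show ?case
      \<comment> \<open>The three instances say, in turn, that the new endpoints are ordered, that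
        the next lower endpoint does not drop, and that the next upper one does not rise.\<close>
      using box mixed_monotone_onD[OF assms(1) m M M m le le]
        mixed_monotone_onD[OF assms(1) m box(1) M box(2) up down]
        mixed_monotone_onD[OF assms(1) box(2) M box(1) m down up]
      by (simp add: mM)
  qed
  then show "a \<le> fst (bracket G a b k)" "snd (bracket G a b k) \<le> b"
    "fst (bracket G a b k) \<le> snd (bracket G a b k)"
    "fst (bracket G a b k) \<le> fst (bracket G a b (Suc k))"
    "snd (bracket G a b (Suc k)) \<le> snd (bracket G a b k)"
    by auto
qed

lemma bracket_limit:
  assumes mono: "mixed_monotone_on ({a..b} \<times> {a..b}) G" "G ` ({a..b} \<times> {a..b}) \<subseteq> {a..b}" "a \<le> b"
    and cont: "continuous_on ({a..b} \<times> {a..b}) G"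
    and no_art: "\<not> (\<exists>p. artificial_fixed_point a b G p)"
  obtains z where "z \<in> {a..b}" "G (z, z) = z" "bracket G a b \<longlonglongrightarrow> (z, z)"
proof -
  note nest = bracket_nested[OF mono]
  have box: "fst (bracket G a b k) \<in> {a..b}" "snd (bracket G a b k) \<in> {a..b}" for k
    using nest[of k] by auto
  have "incseq (\<lambda>k. fst (bracket G a b k))"
    using nest(4) by (rule incseq_SucI)
  then obtain m where m: "(\<lambda>k. fst (bracket G a b k)) \<longlonglongrightarrow> m"
    by (rule incseq_convergent) (use box in auto)
  have "decseq (\<lambda>k. snd (bracket G a b k))"
    using nest(5) by (rule decseq_SucI)
  then obtain M where M: "(\<lambda>k. snd (bracket G a b k)) \<longlonglongrightarrow> M"
    by (rule decseq_convergent) (use box in auto)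
  have m_box: "m \<in> {a..b}" and M_box: "M \<in> {a..b}"
    using closed_sequentially[OF closed_atLeastAtMost box(1) m]
      closed_sequentially[OF closed_atLeastAtMost box(2) M] by auto
  have "(\<lambda>k. G (fst (bracket G a b k), snd (bracket G a b k))) \<longlonglongrightarrow> G (m, M)"
    by (rule continuous_on_tendsto_compose[OF cont tendsto_Pair[OF m M]])
       (use m_box M_box box in \<open>auto simp: mem_Times_iff\<close>)
  \<comment> \<open>By the recursion this is the shifted sequence of lower endpoints, which also
    tends to \<open>m\<close>.\<close>
  then have "(\<lambda>k. fst (bracket G a b (Suc k))) \<longlonglongrightarrow> G (m, M)"
    by simp
  then have 1: "G (m, M) = m"
    using LIMSEQ_unique LIMSEQ_Suc[OF m] by blast
  have "(\<lambda>k. G (snd (bracket G a b k), fst (bracket G a b k))) \<longlonglongrightarrow> G (M, m)"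
    by (rule continuous_on_tendsto_compose[OF cont tendsto_Pair[OF M m]])
       (use m_box M_box box in \<open>auto simp: mem_Times_iff\<close>)
  then have "(\<lambda>k. snd (bracket G a b (Suc k))) \<longlonglongrightarrow> G (M, m)"
    by simp
  then have 2: "G (M, m) = M"
    using LIMSEQ_unique LIMSEQ_Suc[OF M] by blast
  have "\<not> artificial_fixed_point a b G (m, M)"
    using no_art by blast
  then have "m = M"
    using 1 2 m_box M_box by (simp add: artificial_fixed_point_def)
  then show ?thesis
    using that[of m] 1 m_box tendsto_Pair[OF m M] by simp
qed

text \<open>A term depends on its two predecessors, and both must lie in interval \<open>k\<close>
  before the term is forced into interval \<open>k + 1\<close>. Hence two steps per
  interval.\<close>

lemma orbit_in_bracket:
  assumes mono: "mixed_monotone_on ({a..b} \<times> {a..b}) G" "G ` ({a..b} \<times> {a..b}) \<subseteq> {a..b}" "a \<le> b"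
    and inv: "invariant_domain \<Omega> F" "(x0, xm1) \<in> \<Omega>"
    and ext: "\<Omega> \<subseteq> {a..b} \<times> {a..b}" "\<And>p. p \<in> \<Omega> \<Longrightarrow> G p = F p"
    and "2 * k \<le> n"
  shows "orbit F x0 xm1 n \<in> {fst (bracket G a b k)..snd (bracket G a b k)}"
  using \<open>2 * k \<le> n\<close>
proof (induction k arbitrary: n)
  case 0
  show ?case using orbit_in_invariant_domain[OF inv, of n] ext(1) by auto
next
  case (Suc k)
  obtain i where i: "n = Suc (Suc i)" "2 * k \<le> i"
    using Suc.prems by (metis Suc_le_D add_2_eq_Suc mult_Suc_right Suc_le_mono)
  let ?x = "orbit F x0 xm1 (Suc i)" and ?y = "orbit F x0 xm1 i"
  \<comment> \<open>Passing from \<open>F\<close> to \<open>G\<close> allows comparison with the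
    corners \<open>(m, M)\<close> and \<open>(M, m)\<close>, which may lie outside
    \<open>\<Omega>\<close>.\<close>
  have orb: "orbit F x0 xm1 n = G (?x, ?y)"
    using i ext(2) orbit_in_invariant_domain[OF inv, of i] by simp
  obtain m M where mM: "bracket G a b k = (m, M)" by fastforce
  have xy: "m \<le> ?x" "?x \<le> M" "m \<le> ?y" "?y \<le> M"
    using Suc.IH[of "Suc i"] Suc.IH[of i] i by (auto simp: mM)
  have "m \<in> {a..b}" "M \<in> {a..b}" "?x \<in> {a..b}" "?y \<in> {a..b}"
    using bracket_nested[OF mono, of k] xy by (auto simp: mM)
  then have "G (m, M) \<le> G (?x, ?y)" "G (?x, ?y) \<le> G (M, m)"
    using xy by (auto intro!: mixed_monotone_onD[OF mono(1)])
  then show ?case by (simp add: orb mM)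
qed

theorem theorem3p2:
  fixes \<Omega> :: "(real \<times> real) set"
    and F G :: "real \<times> real \<Rightarrow> real"
    and a b :: real
  assumes "compact \<Omega>"
    and "continuous_on \<Omega> F"
    and "mixed_monotone_on \<Omega> F"
    and "invariant_domain \<Omega> F"
    and "nice_extension \<Omega> F a b G"
    and "G ` ({a..b} \<times> {a..b}) \<subseteq> {a..b}"
    and "\<not> (\<exists>p. artificial_fixed_point a b G p)"
  shows "\<forall>x0 xm1. (x0, xm1) \<in> \<Omega> \<longrightarrow>
           (\<exists>z. fixed_point \<Omega> F z \<and> orbit F x0 xm1 \<longlonglongrightarrow> z)"
proof (intro allI impI)
  fix x0 xm1 assume start: "(x0, xm1) \<in> \<Omega>"
  let ?x = "orbit F x0 xm1"
  have sub: "\<Omega> \<subseteq> {a..b} \<times> {a..b}"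
    and cont: "continuous_on ({a..b} \<times> {a..b}) G"
    and eq: "\<And>p. p \<in> \<Omega> \<Longrightarrow> G p = F p"
    and mono: "mixed_monotone_on ({a..b} \<times> {a..b}) G"
    using assms(5) by (auto simp: nice_extension_def is_extension_def)
  have ab: "a \<le> b" using sub start by auto
  obtain z where z: "G (z, z) = z" and lim: "bracket G a b \<longlonglongrightarrow> (z, z)"
    using bracket_limit[OF mono assms(6) ab cont assms(7)] by blast
  \<comment> \<open>\<open>n div 2\<close> is the largest \<open>k\<close> with
    \<open>2 * k \<le> n\<close>, so it selects the smallest interval known to contain the
    \<open>n\<close>-th term.\<close>
  have half: "filterlim (\<lambda>n::nat. n div 2) sequentially sequentially"
    by (simp add: filterlim_at_top eventually_sequentially)
       (metis div_le_mono nonzero_mult_div_cancel_left zero_neq_numeral)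
  have "(\<lambda>n. bracket G a b (n div 2)) \<longlonglongrightarrow> (z, z)"
    using filterlim_compose[OF lim half] .
  then have lims: "(\<lambda>n. fst (bracket G a b (n div 2))) \<longlonglongrightarrow> z"
    "(\<lambda>n. snd (bracket G a b (n div 2))) \<longlonglongrightarrow> z"
    using tendsto_fst tendsto_snd by fastforce+
  have "?x n \<in> {fst (bracket G a b (n div 2))..snd (bracket G a b (n div 2))}" for n
    using orbit_in_bracket[OF mono assms(6) ab assms(4) start sub eq] by simp
  then have conv: "?x \<longlonglongrightarrow> z"
    by (intro tendsto_sandwich[OF _ _ lims]) auto
  \<comment> \<open>So far \<open>z\<close> is a fixed point of \<open>G\<close> only. Consecutive
    pairs of the orbit stay in the closed set \<open>\<Omega>\<close>, which places
    \<open>(z, z)\<close> where \<open>G\<close> agrees with \<open>F\<close>.\<close>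
  have "(\<lambda>n. (?x (Suc n), ?x n)) \<longlonglongrightarrow> (z, z)"
    using LIMSEQ_Suc[OF conv] conv by (rule tendsto_Pair)
  then have "(z, z) \<in> \<Omega>"
    by (rule closed_sequentially[OF compact_imp_closed[OF assms(1)]
          orbit_in_invariant_domain[OF assms(4) start]])
  then have "fixed_point \<Omega> F z"
    using z eq by (simp add: fixed_point_def)
  with conv show "\<exists>z. fixed_point \<Omega> F z \<and> ?x \<longlonglongrightarrow> z" by blast
qed

end
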